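(* Let $B$ be a bicom, $vs$ a list of variables, and $\mathcal R,\mathcal S$ relations such that: (i) $B$ is well-formed; (ii) $\mathrm{biFrame}(B,vs)$ holds; (iii) $vs\Vdash\mathcal R$ and $vs\Vdash\mathcal S$; (iv) $\models \mathrm{chk}(B,vs):\mathcal R\Rrightarrow\mathcal S$. Then $\models \mathrm{L}(B)\mid \mathrm{R}(B):\mathcal R\leadsto_\exists\mathcal S$.
   Context: Variables come from two disjoint countably infinite sets, of integer variables and of boolean variables. A store is a total function $s$ mapping each integer variable to an integer and each boolean variable to a truth value in $\{\mathrm{tt},\mathrm{ff}\}$; $\mathsf{Store}$ is the set of stores and $s[x\mapsto n]$ is $s$ updated at $x$ to $n$. An integer (resp. boolean) expression is an arbitrary total function $\mathsf{Store}\to\mathbb Z$ (resp. $\mathsf{Store}\to\{\mathrm{tt},\mathrm{ff}\}$); a boolean expression $e$ is identified with the assertion $\{s:e(s)=\mathrm{tt}\}$, and $\mathrm{tt},\mathrm{ff}$ also denote constant expressions. An assertion is a subset of $\mathsf{Store}$, a relation is a subset of $\mathsf{Store}\times\mathsf{Store}$, and a two-state expression is a function $E:\mathsf{Store}\times\mathsf{Store}\to\mathbb Z$. Write $s\models p$ for $s\in p$ and $s,s'\models\mathcal R$ for $(s,s')\in\mathcal R$. Connectives on assertions/relations denote set operations; $\mathrm{ff}$ as a relation is $\emptyset$. $\exists|x.\mathcal P=\{(s,s'):(s,s'[x\mapsto v])\in\mathcal P$ for some value $v$ of the type of $x\}$. Commands: $c::=\mathsf{skip}\mid x:=e\mid\mathsf{hav}\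 x\mid\mathsf{assert}\ p\mid c;c\mid\mathsf{if}\ e\ \mathsf{then}\ c\ \mathsf{else}\ c\mid\mathsf{while}\ e\ \mathsf{vnt}\ e_1\ \mathsf{do}\ c$ ($p$ an assertion, $e_1$ an integer "variant" expression with no semantic effect; type-correct). Big-step semantics $c/s\Downarrow\phi$, $\phi\in\mathsf{Store}\cup\{\mathsf{fail}\}$, is the least relation with: $\mathsf{skip}/s\Downarrow s$; $x:=e/s\Downarrow s[x\mapsto e(s)]$; $\mathsf{hav}\ x/s\Downarrow s[x\mapsto n]$ for every value $n$ of the type of $x$; $\mathsf{assert}\ p/s\Downarrow s$ if $s\in p$, $\Downarrow\mathsf{fail}$ otherwise; $c;d/s\Downarrow\mathsf{fail}$ if $c/s\Downarrow\mathsf{fail}$, and $c;d/s\Downarrow\phi$ if $c/s\Downarrow t$ and $d/t\Downarrow\phi$; $\mathsf{if}\ e\ \mathsf{then}\ c\ \mathsf{else}\ d/s\Downarrow\phi$ if ($s\models e$ and $c/s\Downarrow\phi$) or ($s\not\models e$ and $d/s\Downarrow\phi$); a loop $w=\mathsf{while}\ e\ \mathsf{vnt}\ e_1\ \mathsf{do}\ c$ has $w/s\Downarrow s$ if $s\not\models e$, $w/s\Downarrow\mathsf{fail}$ if $s\models e$ and $c/s\Downarrow\mathsf{fail}$, and $w/s\Downarrow\phi$ if $s\models e$, $c/s\Downarrow t$, $w/t\Downarrow\phi$. $\models c\mid c':\mathcal R\leadsto_\exists\mathcal S$ means: for all $(s,s')\in\mathcal R$, not $c/s\Downarrow\mathsf{fail}$,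 and for every $t$ with $c/s\Downarrow t$ there is $t'$ with $c'/s'\Downarrow t'$ and $(t,t')\in\mathcal S$. Kat equivalence $\simeq$ is the least congruence on commands (w.r.t. sequence, if, while; variants unchanged) with $\mathsf{skip};c\simeq c$, $c;\mathsf{skip}\simeq c$, $(\mathsf{if}\ \mathrm{tt}\ \mathsf{then}\ c\ \mathsf{else}\ d)\simeq c$, $(\mathsf{while}\ \mathrm{ff}\ \mathsf{vnt}\ e_1\ \mathsf{do}\ c)\simeq\mathsf{skip}$. Bicoms: $B::=\langle c\mid c'\rangle\mid\mathsf{assert}\ \mathcal P\mid\mathsf{havf}\ x\ \mathcal P\mid B;B\mid\mathsf{if}\ e|e'\ B_1\ B_2\ B_3\ B_4\mid\mathsf{while}\ e|e'\ \mathsf{algn}\ \mathcal L|\mathcal R\ \mathsf{vnt}\ E\ \mathsf{do}\ B$ ($\mathcal P,\mathcal L,\mathcal R$ relations, $E$ a two-state expression with no semantic effect). Left projection $\mathrm{L}$: $\mathrm{L}\langle c|c'\rangle=c$, $\mathrm{L}(\mathsf{assert}\ \mathcal P)=\mathrm{L}(\mathsf{havf}\ x\ \mathcal P)=\mathsf{skip}$, $\mathrm{L}(B_1;B_2)=\mathrm{L}(B_1);\mathrm{L}(B_2)$, $\mathrm{L}(\mathsf{if}\ e|e'\ B_1B_2B_3B_4)=\mathsf{if}\ e\ \mathsf{then}\ \mathrm{L}(B_1)\ \mathsf{else}\ \mathrm{L}(B_3)$, $\mathrm{L}(\mathsf{while}\ e|e'\ldots\mathsf{do}\ B)=\mathsf{while}\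 e\ \mathsf{do}\ \mathrm{L}(B)$. Right projection $\mathrm{R}$: $\mathrm{R}\langle c|c'\rangle=c'$, $\mathrm{R}(\mathsf{assert}\ \mathcal P)=\mathsf{skip}$, $\mathrm{R}(\mathsf{havf}\ x\ \mathcal P)=\mathsf{hav}\ x$, $\mathrm{R}(B_1;B_2)=\mathrm{R}(B_1);\mathrm{R}(B_2)$, $\mathrm{R}(\mathsf{if}\ e|e'\ B_1B_2B_3B_4)=\mathsf{if}\ e'\ \mathsf{then}\ \mathrm{R}(B_1)\ \mathsf{else}\ \mathrm{R}(B_2)$, $\mathrm{R}(\mathsf{while}\ e|e'\ldots\mathsf{do}\ B)=\mathsf{while}\ e'\ \mathsf{do}\ \mathrm{R}(B)$. $\mathrm{biL}(B)=\langle\mathrm{L}(B)\mid\mathsf{skip}\rangle$; $\mathrm{biR}$: $\langle c|c'\rangle\mapsto\langle\mathsf{skip}|c'\rangle$, $\mathsf{assert}\ \mathcal P$ and $\mathsf{havf}\ x\ \mathcal P$ unchanged, $B_1;B_2\mapsto\mathrm{biR}(B_1);\mathrm{biR}(B_2)$, $\mathsf{if}\ e|e'\ B_1..B_4\mapsto\mathsf{if}\ \mathrm{tt}|e'\ \mathrm{biR}(B_1)..\mathrm{biR}(B_4)$, $\mathsf{while}\ e|e'\ \mathsf{algn}\ \mathcal L|\mathcal R\ \mathsf{vnt}\ E\ \mathsf{do}\ B\mapsto\mathsf{while}\ \mathrm{ff}|e'\ \mathsf{algn}\ \mathrm{ff}|\mathcal R\ \mathsf{vnt}\ E\ \mathsf{do}\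 \mathrm{biR}(B)$. $B$ is well-formed iff each sub-bicom $\mathsf{if}\ e|e'\ B_1B_2B_3B_4$ satisfies $\mathrm{L}(B_1)\simeq\mathrm{L}(B_2)$, $\mathrm{L}(B_3)\simeq\mathrm{L}(B_4)$, $\mathrm{R}(B_1)\simeq\mathrm{R}(B_3)$, $\mathrm{R}(B_2)\simeq\mathrm{R}(B_4)$. Bicom semantics $B/(s,s')\Downarrow\varphi$, $\varphi\in(\mathsf{Store}\times\mathsf{Store})\cup\{\mathsf{fail}\}$, least relation with: $\langle c|c'\rangle/(s,s')\Downarrow\mathsf{fail}$ if $c/s\Downarrow\mathsf{fail}$, or if $c/s\Downarrow t$ and $c'/s'\Downarrow\mathsf{fail}$; $\Downarrow(t,t')$ if $c/s\Downarrow t$ and $c'/s'\Downarrow t'$. $\mathsf{assert}\ \mathcal P/(s,s')\Downarrow(s,s')$ if $(s,s')\in\mathcal P$, else $\Downarrow\mathsf{fail}$. $\mathsf{havf}\ x\ \mathcal P/(s,s')\Downarrow(s,s'[x\mapsto n])$ for every value $n$ of the type of $x$ with $(s,s'[x\mapsto n])\in\mathcal P$. $B_1;B_2/(s,s')\Downarrow\mathsf{fail}$ if $B_1/(s,s')\Downarrow\mathsf{fail}$; $\Downarrow\varphi$ if $B_1/(s,s')\Downarrow(t,t')$ and $B_2/(t,t')\Downarrow\varphi$. $\mathsf{if}\ e|e'\ B_1B_2B_3B_4/(s,s')\Downarrow\varphi$ if $B_i/(s,s')\Downarrow\varphi$ where $i=1,2,3,4$ according as ($s\models e,s'\models e'$),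 ($s\models e,s'\not\models e'$), ($s\not\models e,s'\models e'$), ($s\not\models e,s'\not\models e'$). For $W=\mathsf{while}\ e|e'\ \mathsf{algn}\ \mathcal L|\mathcal R\ \mathsf{vnt}\ E\ \mathsf{do}\ B$: $W/(s,s')\Downarrow(s,s')$ if $s\not\models e$ and $s'\not\models e'$; if $s\models e$ and $(s,s')\in\mathcal L$, then $W/(s,s')\Downarrow\mathsf{fail}$ when $\mathrm{biL}(B)/(s,s')\Downarrow\mathsf{fail}$, and $W/(s,s')\Downarrow\varphi$ when $\mathrm{biL}(B)/(s,s')\Downarrow(t,t')$ and $W/(t,t')\Downarrow\varphi$; if not($s\models e$ and $(s,s')\in\mathcal L$), $s'\models e'$ and $(s,s')\in\mathcal R$, the same with $\mathrm{biR}(B)$ in place of $\mathrm{biL}(B)$; if $s\models e$, $s'\models e'$, $(s,s')\notin\mathcal L$, $(s,s')\notin\mathcal R$, the same with $B$; and $W/(s,s')\Downarrow\mathsf{fail}$ if ($s\models e$, $s'\not\models e'$, $(s,s')\notin\mathcal L$) or ($s\not\models e$, $s'\models e'$, $(s,s')\notin\mathcal R$). $\models B:\mathcal R\Rrightarrow\mathcal S$ means: for all $(s,s')\in\mathcal R$, not $B/(s,s')\Downarrow\mathsf{fail}$, and $(t,t')\in\mathcal S$ whenever $B/(s,s')\Downarrow(t,t')$. Frames: $vs$ is a list of variables; $s=_{vs}t$ iff $s(x)=t(x)$ for all $x\in vs$. $vs\Vdash e$ iff $s=_{vs}t\Rightarrow e(s)=e(t)$; $vs\Vdash p$ iff $s=_{vs}t\Rightarrow(s\in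 p\iff t\in p)$; $vs\Vdash E$ iff $s=_{vs}t\wedge s'=_{vs}t'\Rightarrow E(s,s')=E(t,t')$; $vs\Vdash\mathcal R$ iff $s=_{vs}t\wedge s'=_{vs}t'\Rightarrow((s,s')\in\mathcal R\iff(t,t')\in\mathcal R)$. $\mathrm{cFrame}(c,vs)$: $\mathrm{tt}$ for $\mathsf{skip}$; $x\in vs\wedge vs\Vdash e$ for $x:=e$; $x\in vs$ for $\mathsf{hav}\ x$; $vs\Vdash p$ for $\mathsf{assert}\ p$; conjunction over components for $c_1;c_2$; $vs\Vdash e$ plus both branches for if; $vs\Vdash e\wedge vs\Vdash e_1\wedge\mathrm{cFrame}(c_1,vs)$ for $\mathsf{while}\ e\ \mathsf{vnt}\ e_1\ \mathsf{do}\ c_1$. $\mathrm{biFrame}(B,vs)$: $\mathrm{cFrame}(c,vs)\wedge\mathrm{cFrame}(c',vs)$ for $\langle c|c'\rangle$; $vs\Vdash\mathcal P$ for $\mathsf{assert}\ \mathcal P$; $x\in vs\wedge vs\Vdash\mathcal P$ for $\mathsf{havf}\ x\ \mathcal P$; conjunction for $B_1;B_2$; $vs\Vdash e$, $vs\Vdash e'$ and all four $\mathrm{biFrame}(B_i,vs)$ for bi-if; $vs\Vdash e,e',\mathcal P,\mathcal P',E$ and $\mathrm{biFrame}(B_1,vs)$ for $\mathsf{while}\ e|e'\ \mathsf{algn}\ \mathcal P|\mathcal P'\ \mathsf{vnt}\ E\ \mathsf{do}\ B_1$. $\mathrm{modVars}(c)$ is the list of variables assigned or havoc'd in $c$; $\mathrm{modVarsR}(B)$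 lists the variables $x$ of $\mathsf{havf}\ x\ \mathcal P$ in $B$ together with $\mathrm{modVars}(c')$ for each $\langle c|c'\rangle$ in $B$. Unary check $\mathrm{uchk}(c,vs)$: identity on $\mathsf{skip}$, assignment, havoc, assert; homomorphic on sequence and if; $\mathrm{uchk}(\mathsf{while}\ e\ \mathsf{vnt}\ e_1\ \mathsf{do}\ c_1,vs)=\mathsf{while}\ e\ \mathsf{vnt}\ e_1\ \mathsf{do}\ (x:=e_1;\mathrm{uchk}(c_1,vs);\mathsf{assert}\ \{s:0\le e_1(s)<s(x)\})$, where $x$ is an integer variable not in $vs$ nor in $\mathrm{modVars}(\mathrm{uchk}(c_1,vs))$, chosen by a fixed choice function. Bicom check $\mathrm{chk}(B,vs)$: $\langle c|c'\rangle\mapsto\langle c\mid\mathrm{uchk}(c',vs)\rangle$; $\mathsf{assert}\ \mathcal P$ unchanged; $\mathsf{havf}\ x\ \mathcal P\mapsto\mathsf{assert}(\exists|x.\mathcal P);\mathsf{havf}\ x\ \mathcal P$; homomorphic on sequence and bi-if (same $vs$ in recursive calls); $\mathsf{while}\ e|e'\ \mathsf{algn}\ \mathcal P|\mathcal P'\ \mathsf{vnt}\ E\ \mathsf{do}\ B_1\mapsto\mathsf{while}\ e|e'\ \mathsf{algn}\ \mathcal P|\mathcal P'\ \mathsf{vnt}\ E\ \mathsf{do}\ B_2$ with $B_2=\mathsf{havf}\ x_1\ \{(s,s'):s'(x_1)=E(s,s')\};\ \mathsf{havf}\ x_2\ \{(s,s'):s'(x_2)=\mathrm{tt}\iff(s'\models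 e'\wedge(s,s')\in\mathcal P')\};\ \mathrm{chk}(B_1,vs);\ \mathsf{assert}\ \{(s,s'):s'(x_2)=\mathrm{tt}\Rightarrow 0\le E(s,s')<s'(x_1)\}$, where $x_1$ (integer) and $x_2$ (boolean) are distinct, not in $vs$ nor in $\mathrm{modVarsR}(\mathrm{chk}(B_1,vs))$, chosen by a fixed choice function. *)

theory Defs imports Main begin

section \<open>Variables, stores, expressions\<close>

datatype var = IVar nat | BVar nat

record store =
  ints :: "nat \<Rightarrow> int"
  bools :: "nat \<Rightarrow> bool"

definition upd_int :: "store \<Rightarrow> nat \<Rightarrow> int \<Rightarrow> store" where
  "upd_int s i n = s\<lparr>ints := (ints s)(i := n)\<rparr>"

definition upd_bool :: "store \<Rightarrow> nat \<Rightarrow> bool \<Rightarrow> store" where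
  "upd_bool s i b = s\<lparr>bools := (bools s)(i := b)\<rparr>"

text \<open>The set of all stores \<open>s[x \<mapsto> n]\<close>, with \<open>n\<close> ranging over the values of the type of \<open>x\<close>.\<close>

fun updates :: "store \<Rightarrow> var \<Rightarrow> store set" where
  "updates s (IVar i) = range (upd_int s i)"
| "updates s (BVar i) = range (upd_bool s i)"

type_synonym iexp = "store \<Rightarrow> int"
type_synonym bexp = "store \<Rightarrow> bool"
type_synonym assn = "store set"
type_synonym iexp2 = "store \<times> store \<Rightarrow> int"

text \<open>\<open>ex_right x P\<close> is the relation \<open>\<exists>|x. P\<close>.\<close>

definition ex_right :: "var \<Rightarrow> store rel \<Rightarrow> store rel" where
  "ex_right x P = {(s, s'). \<exists>t' \<in> updates s' x. (s, t') \<in> P}"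

section \<open>Commands\<close>

datatype com =
    Skip
  | AssignI nat iexp
  | AssignB nat bexp
  | Hav var
  | Assert assn
  | Seq com com
  | Cond bexp com com
  | While bexp iexp com  \<comment> \<open>guard, variant, body\<close>

datatype 'a outcome = Fail | Final 'a

inductive cexec :: "com \<Rightarrow> store \<Rightarrow> store outcome \<Rightarrow> bool" where
  c_skip: "cexec Skip s (Final s)"
| c_assignI: "cexec (AssignI i e) s (Final (upd_int s i (e s)))"
| c_assignB: "cexec (AssignB i e) s (Final (upd_bool s i (e s)))"
| c_hav: "t \<in> updates s x \<Longrightarrow> cexec (Hav x) s (Final t)"
| c_assert: "s \<in> p \<Longrightarrow> cexec (Assert p) s (Final s)"
| c_assert_fail: "s \<notin> p \<Longrightarrow> cexec (Assert p) s Fail"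
| c_seq_fail: "cexec c s Fail \<Longrightarrow> cexec (Seq c d) s Fail"
| c_seq: "cexec c s (Final t) \<Longrightarrow> cexec d t \<phi> \<Longrightarrow> cexec (Seq c d) s \<phi>"
| c_cond_true: "e s \<Longrightarrow> cexec c s \<phi> \<Longrightarrow> cexec (Cond e c d) s \<phi>"
| c_cond_false: "\<not> e s \<Longrightarrow> cexec d s \<phi> \<Longrightarrow> cexec (Cond e c d) s \<phi>"
| c_while_done: "\<not> e s \<Longrightarrow> cexec (While e v c) s (Final s)"
| c_while_fail: "e s \<Longrightarrow> cexec c s Fail \<Longrightarrow> cexec (While e v c) s Fail"
| c_while_step: "e s \<Longrightarrow> cexec c s (Final t) \<Longrightarrow> cexec (While e v c) t \<phi> \<Longrightarrow>
    cexec (While e v c) s \<phi>"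

text \<open>\<open>valid_ae c c' R S\<close> is the forall-exists judgement \<open>\<Turnstile> c | c' : R \<leadsto>\<^sub>\<exists> S\<close>.\<close>

definition valid_ae :: "com \<Rightarrow> com \<Rightarrow> store rel \<Rightarrow> store rel \<Rightarrow> bool" where
  "valid_ae c c' R S \<longleftrightarrow>
     (\<forall>(s, s') \<in> R.
        \<not> cexec c s Fail \<and>
        (\<forall>t. cexec c s (Final t) \<longrightarrow> (\<exists>t'. cexec c' s' (Final t') \<and> (t, t') \<in> S)))"

inductive kat_equiv :: "com \<Rightarrow> com \<Rightarrow> bool" where
  k_refl: "kat_equiv c c"
| k_sym: "kat_equiv c d \<Longrightarrow> kat_equiv d c"
| k_trans: "kat_equiv c d \<Longrightarrow> kat_equiv d b \<Longrightarrow> kat_equiv c b"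
| k_seq: "kat_equiv c c' \<Longrightarrow> kat_equiv d d' \<Longrightarrow> kat_equiv (Seq c d) (Seq c' d')"
| k_cond: "kat_equiv c c' \<Longrightarrow> kat_equiv d d' \<Longrightarrow> kat_equiv (Cond e c d) (Cond e c' d')"
| k_while: "kat_equiv c c' \<Longrightarrow> kat_equiv (While e v c) (While e v c')"
| k_skip_left: "kat_equiv (Seq Skip c) c"
| k_skip_right: "kat_equiv (Seq c Skip) c"
| k_cond_tt: "kat_equiv (Cond (\<lambda>_. True) c d) c"
| k_while_ff: "kat_equiv (While (\<lambda>_. False) v c) Skip"

section \<open>Bicoms\<close>

datatype bicom =
    Embed com com
  | BAssert "store rel"
  | Havf var "store rel"
  | BSeq bicom bicom
  | BCond bexp bexp bicom bicom bicom bicom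
  | BWhile bexp bexp "store rel" "store rel" iexp2 bicom
      \<comment> \<open>left and right guard, left and right alignment condition, variant, body\<close>

text \<open>A projected loop has no variant of its own: the two-state variant of a bi-while does not
  project to a one-state expression. As the syntax of loops requires one, the constant \<open>0\<close> is
  used.\<close>

primrec projL :: "bicom \<Rightarrow> com" where
  "projL (Embed c c') = c"
| "projL (BAssert P) = Skip"
| "projL (Havf x P) = Skip"
| "projL (BSeq B1 B2) = Seq (projL B1) (projL B2)"
| "projL (BCond e e' B1 B2 B3 B4) = Cond e (projL B1) (projL B3)"
| "projL (BWhile e e' P P' E B) = While e (\<lambda>_. 0) (projL B)"

primrec projR :: "bicom \<Rightarrow> com" where
  "projR (Embed c c') = c'"
| "projR (BAssert P) = Skip"
| "projR (Havf x P) = Hav x"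
| "projR (BSeq B1 B2) = Seq (projR B1) (projR B2)"
| "projR (BCond e e' B1 B2 B3 B4) = Cond e' (projR B1) (projR B2)"
| "projR (BWhile e e' P P' E B) = While e' (\<lambda>_. 0) (projR B)"

definition biL :: "bicom \<Rightarrow> bicom" where
  "biL B = Embed (projL B) Skip"

primrec biR :: "bicom \<Rightarrow> bicom" where
  "biR (Embed c c') = Embed Skip c'"
| "biR (BAssert P) = BAssert P"
| "biR (Havf x P) = Havf x P"
| "biR (BSeq B1 B2) = BSeq (biR B1) (biR B2)"
| "biR (BCond e e' B1 B2 B3 B4) = BCond (\<lambda>_. True) e' (biR B1) (biR B2) (biR B3) (biR B4)"
| "biR (BWhile e e' P P' E B) = BWhile (\<lambda>_. False) e' {} P' E (biR B)"

primrec well_formed :: "bicom \<Rightarrow> bool" where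
  "well_formed (Embed c c') \<longleftrightarrow> True"
| "well_formed (BAssert P) \<longleftrightarrow> True"
| "well_formed (Havf x P) \<longleftrightarrow> True"
| "well_formed (BSeq B1 B2) \<longleftrightarrow> well_formed B1 \<and> well_formed B2"
| "well_formed (BCond e e' B1 B2 B3 B4) \<longleftrightarrow>
     kat_equiv (projL B1) (projL B2) \<and> kat_equiv (projL B3) (projL B4) \<and>
     kat_equiv (projR B1) (projR B3) \<and> kat_equiv (projR B2) (projR B4) \<and>
     well_formed B1 \<and> well_formed B2 \<and> well_formed B3 \<and> well_formed B4"
| "well_formed (BWhile e e' P P' E B) \<longleftrightarrow> well_formed B"

inductive bexec :: "bicom \<Rightarrow> store \<times> store \<Rightarrow> (store \<times> store) outcome \<Rightarrow> bool" where
  b_embed_failL: "cexec c s Fail \<Longrightarrow> bexec (Embed c c') (s, s') Fail"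
| b_embed_failR: "cexec c s (Final t) \<Longrightarrow> cexec c' s' Fail \<Longrightarrow> bexec (Embed c c') (s, s') Fail"
| b_embed: "cexec c s (Final t) \<Longrightarrow> cexec c' s' (Final t') \<Longrightarrow>
    bexec (Embed c c') (s, s') (Final (t, t'))"
| b_assert: "(s, s') \<in> P \<Longrightarrow> bexec (BAssert P) (s, s') (Final (s, s'))"
| b_assert_fail: "(s, s') \<notin> P \<Longrightarrow> bexec (BAssert P) (s, s') Fail"
| b_havf: "t' \<in> updates s' x \<Longrightarrow> (s, t') \<in> P \<Longrightarrow> bexec (Havf x P) (s, s') (Final (s, t'))"
| b_seq_fail: "bexec B1 (s, s') Fail \<Longrightarrow> bexec (BSeq B1 B2) (s, s') Fail"
| b_seq: "bexec B1 (s, s') (Final (t, t')) \<Longrightarrow> bexec B2 (t, t') \<phi> \<Longrightarrow>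
    bexec (BSeq B1 B2) (s, s') \<phi>"
| b_cond_tt: "e s \<Longrightarrow> e' s' \<Longrightarrow> bexec B1 (s, s') \<phi> \<Longrightarrow>
    bexec (BCond e e' B1 B2 B3 B4) (s, s') \<phi>"
| b_cond_tf: "e s \<Longrightarrow> \<not> e' s' \<Longrightarrow> bexec B2 (s, s') \<phi> \<Longrightarrow>
    bexec (BCond e e' B1 B2 B3 B4) (s, s') \<phi>"
| b_cond_ft: "\<not> e s \<Longrightarrow> e' s' \<Longrightarrow> bexec B3 (s, s') \<phi> \<Longrightarrow>
    bexec (BCond e e' B1 B2 B3 B4) (s, s') \<phi>"
| b_cond_ff: "\<not> e s \<Longrightarrow> \<not> e' s' \<Longrightarrow> bexec B4 (s, s') \<phi> \<Longrightarrow>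
    bexec (BCond e e' B1 B2 B3 B4) (s, s') \<phi>"
| b_while_done: "\<not> e s \<Longrightarrow> \<not> e' s' \<Longrightarrow>
    bexec (BWhile e e' P P' E B) (s, s') (Final (s, s'))"
| b_while_left_fail: "e s \<Longrightarrow> (s, s') \<in> P \<Longrightarrow> bexec (biL B) (s, s') Fail \<Longrightarrow>
    bexec (BWhile e e' P P' E B) (s, s') Fail"
| b_while_left: "e s \<Longrightarrow> (s, s') \<in> P \<Longrightarrow> bexec (biL B) (s, s') (Final (t, t')) \<Longrightarrow>
    bexec (BWhile e e' P P' E B) (t, t') \<phi> \<Longrightarrow> bexec (BWhile e e' P P' E B) (s, s') \<phi>"
| b_while_right_fail: "\<not> (e s \<and> (s, s') \<in> P) \<Longrightarrow> e' s' \<Longrightarrow> (s, s') \<in> P' \<Longrightarrow>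
    bexec (biR B) (s, s') Fail \<Longrightarrow> bexec (BWhile e e' P P' E B) (s, s') Fail"
| b_while_right: "\<not> (e s \<and> (s, s') \<in> P) \<Longrightarrow> e' s' \<Longrightarrow> (s, s') \<in> P' \<Longrightarrow>
    bexec (biR B) (s, s') (Final (t, t')) \<Longrightarrow>
    bexec (BWhile e e' P P' E B) (t, t') \<phi> \<Longrightarrow> bexec (BWhile e e' P P' E B) (s, s') \<phi>"
| b_while_both_fail: "e s \<Longrightarrow> e' s' \<Longrightarrow> (s, s') \<notin> P \<Longrightarrow> (s, s') \<notin> P' \<Longrightarrow>
    bexec B (s, s') Fail \<Longrightarrow> bexec (BWhile e e' P P' E B) (s, s') Fail"
| b_while_both: "e s \<Longrightarrow> e' s' \<Longrightarrow> (s, s') \<notin> P \<Longrightarrow> (s, s') \<notin> P' \<Longrightarrow>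
    bexec B (s, s') (Final (t, t')) \<Longrightarrow>
    bexec (BWhile e e' P P' E B) (t, t') \<phi> \<Longrightarrow> bexec (BWhile e e' P P' E B) (s, s') \<phi>"
| b_while_stuckL: "e s \<Longrightarrow> \<not> e' s' \<Longrightarrow> (s, s') \<notin> P \<Longrightarrow>
    bexec (BWhile e e' P P' E B) (s, s') Fail"
| b_while_stuckR: "\<not> e s \<Longrightarrow> e' s' \<Longrightarrow> (s, s') \<notin> P' \<Longrightarrow>
    bexec (BWhile e e' P P' E B) (s, s') Fail"

text \<open>\<open>valid_aa B R S\<close> is the forall-forall judgement \<open>\<Turnstile> B : R \<Rrightarrow> S\<close>.\<close>

definition valid_aa :: "bicom \<Rightarrow> store rel \<Rightarrow> store rel \<Rightarrow> bool" where
  "valid_aa B R S \<longleftrightarrow>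
     (\<forall>(s, s') \<in> R.
        \<not> bexec B (s, s') Fail \<and>
        (\<forall>t t'. bexec B (s, s') (Final (t, t')) \<longrightarrow> (t, t') \<in> S))"

section \<open>Frames\<close>

definition agree :: "var list \<Rightarrow> store \<Rightarrow> store \<Rightarrow> bool" where
  "agree vs s t \<longleftrightarrow>
     (\<forall>i. IVar i \<in> set vs \<longrightarrow> ints s i = ints t i) \<and>
     (\<forall>i. BVar i \<in> set vs \<longrightarrow> bools s i = bools t i)"

definition exp_frame :: "var list \<Rightarrow> (store \<Rightarrow> 'a) \<Rightarrow> bool" where
  "exp_frame vs e \<longleftrightarrow> (\<forall>s t. agree vs s t \<longrightarrow> e s = e t)"

definition assn_frame :: "var list \<Rightarrow> assn \<Rightarrow> bool" where
  "assn_frame vs p \<longleftrightarrow> (\<forall>s t. agree vs s t \<longrightarrow> (s \<in> p \<longleftrightarrow> t \<in> p))"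

definition exp2_frame :: "var list \<Rightarrow> iexp2 \<Rightarrow> bool" where
  "exp2_frame vs E \<longleftrightarrow>
     (\<forall>s t s' t'. agree vs s t \<and> agree vs s' t' \<longrightarrow> E (s, s') = E (t, t'))"

definition rel_frame :: "var list \<Rightarrow> store rel \<Rightarrow> bool" where
  "rel_frame vs R \<longleftrightarrow>
     (\<forall>s t s' t'. agree vs s t \<and> agree vs s' t' \<longrightarrow> ((s, s') \<in> R \<longleftrightarrow> (t, t') \<in> R))"

primrec cFrame :: "com \<Rightarrow> var list \<Rightarrow> bool" where
  "cFrame Skip vs \<longleftrightarrow> True"
| "cFrame (AssignI i e) vs \<longleftrightarrow> IVar i \<in> set vs \<and> exp_frame vs e"
| "cFrame (AssignB i e) vs \<longleftrightarrow> BVar i \<in> set vs \<and> exp_frame vs e"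
| "cFrame (Hav x) vs \<longleftrightarrow> x \<in> set vs"
| "cFrame (Assert p) vs \<longleftrightarrow> assn_frame vs p"
| "cFrame (Seq c d) vs \<longleftrightarrow> cFrame c vs \<and> cFrame d vs"
| "cFrame (Cond e c d) vs \<longleftrightarrow> exp_frame vs e \<and> cFrame c vs \<and> cFrame d vs"
| "cFrame (While e v c) vs \<longleftrightarrow> exp_frame vs e \<and> exp_frame vs v \<and> cFrame c vs"

primrec biFrame :: "bicom \<Rightarrow> var list \<Rightarrow> bool" where
  "biFrame (Embed c c') vs \<longleftrightarrow> cFrame c vs \<and> cFrame c' vs"
| "biFrame (BAssert P) vs \<longleftrightarrow> rel_frame vs P"
| "biFrame (Havf x P) vs \<longleftrightarrow> x \<in> set vs \<and> rel_frame vs P"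
| "biFrame (BSeq B1 B2) vs \<longleftrightarrow> biFrame B1 vs \<and> biFrame B2 vs"
| "biFrame (BCond e e' B1 B2 B3 B4) vs \<longleftrightarrow>
     exp_frame vs e \<and> exp_frame vs e' \<and>
     biFrame B1 vs \<and> biFrame B2 vs \<and> biFrame B3 vs \<and> biFrame B4 vs"
| "biFrame (BWhile e e' P P' E B) vs \<longleftrightarrow>
     exp_frame vs e \<and> exp_frame vs e' \<and> rel_frame vs P \<and> rel_frame vs P' \<and>
     exp2_frame vs E \<and> biFrame B vs"

section \<open>The check instrumentation\<close>

primrec modVars :: "com \<Rightarrow> var list" where
  "modVars Skip = []"
| "modVars (AssignI i e) = [IVar i]"
| "modVars (AssignB i e) = [BVar i]"
| "modVars (Hav x) = [x]"
| "modVars (Assert p) = []"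
| "modVars (Seq c d) = modVars c @ modVars d"
| "modVars (Cond e c d) = modVars c @ modVars d"
| "modVars (While e v c) = modVars c"

primrec modVarsR :: "bicom \<Rightarrow> var list" where
  "modVarsR (Embed c c') = modVars c'"
| "modVarsR (BAssert P) = []"
| "modVarsR (Havf x P) = [x]"
| "modVarsR (BSeq B1 B2) = modVarsR B1 @ modVarsR B2"
| "modVarsR (BCond e e' B1 B2 B3 B4) = modVarsR B1 @ modVarsR B2 @ modVarsR B3 @ modVarsR B4"
| "modVarsR (BWhile e e' P P' E B) = modVarsR B"

text \<open>The choice functions for fresh integer and boolean variables are parameters of the
  instrumentation. Given the list of variables to be avoided, \<open>fi\<close> returns (the index of) an
  integer variable and \<open>fb\<close> (that of) a boolean variable not in the list.\<close>

definition fresh_choice :: "(var list \<Rightarrow> nat) \<Rightarrow> (var list \<Rightarrow> nat) \<Rightarrow> bool" where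
  "fresh_choice fi fb \<longleftrightarrow> (\<forall>xs. IVar (fi xs) \<notin> set xs \<and> BVar (fb xs) \<notin> set xs)"

lemma fresh_choice_exists: "\<exists>fi fb. fresh_choice fi fb"
proof -
  have *: "\<exists>i. f i \<notin> set xs" if "inj f" for f :: "nat \<Rightarrow> var" and xs
    using that by (metis List.finite_set UNIV_I finite_subset image_subsetI infinite_UNIV_nat
        finite_imageD inj_on_subset subset_UNIV)
  have "inj IVar" "inj BVar" by (auto intro: injI)
  then show ?thesis unfolding fresh_choice_def using *[of IVar] *[of BVar] by metis
qed

primrec uchk :: "(var list \<Rightarrow> nat) \<Rightarrow> com \<Rightarrow> var list \<Rightarrow> com" where
  "uchk fi Skip vs = Skip"
| "uchk fi (AssignI i e) vs = AssignI i e"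
| "uchk fi (AssignB i e) vs = AssignB i e"
| "uchk fi (Hav x) vs = Hav x"
| "uchk fi (Assert p) vs = Assert p"
| "uchk fi (Seq c d) vs = Seq (uchk fi c vs) (uchk fi d vs)"
| "uchk fi (Cond e c d) vs = Cond e (uchk fi c vs) (uchk fi d vs)"
| "uchk fi (While e v c) vs =
     (let c1 = uchk fi c vs;
          x = fi (vs @ modVars c1)
      in While e v
           (Seq (AssignI x v) (Seq c1 (Assert {s. 0 \<le> v s \<and> v s < ints s x}))))"

primrec chk :: "(var list \<Rightarrow> nat) \<Rightarrow> (var list \<Rightarrow> nat) \<Rightarrow> bicom \<Rightarrow> var list \<Rightarrow> bicom" where
  "chk fi fb (Embed c c') vs = Embed c (uchk fi c' vs)"
| "chk fi fb (BAssert P) vs = BAssert P"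
| "chk fi fb (Havf x P) vs = BSeq (BAssert (ex_right x P)) (Havf x P)"
| "chk fi fb (BSeq B1 B2) vs = BSeq (chk fi fb B1 vs) (chk fi fb B2 vs)"
| "chk fi fb (BCond e e' B1 B2 B3 B4) vs =
     BCond e e' (chk fi fb B1 vs) (chk fi fb B2 vs) (chk fi fb B3 vs) (chk fi fb B4 vs)"
| "chk fi fb (BWhile e e' P P' E B) vs =
     (let B1 = chk fi fb B vs;
          x1 = fi (vs @ modVarsR B1);
          x2 = fb (vs @ modVarsR B1)
      in BWhile e e' P P' E
           (BSeq (Havf (IVar x1) {(s, s'). ints s' x1 = E (s, s')})
           (BSeq (Havf (BVar x2) {(s, s'). bools s' x2 \<longleftrightarrow> e' s' \<and> (s, s') \<in> P'})
           (BSeq B1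
                 (BAssert {(s, s'). bools s' x2 \<longrightarrow>
                    0 \<le> E (s, s') \<and> E (s, s') < ints s' x1})))))"

end

theory Submission imports Defs begin

text \<open>
  The instrumented bicom is simulated, with identical left stores and right stores agreeing on the
  frame: as long as it does not fail, every run of the left projection can be matched by a run of
  the right projection and by one of the instrumented bicom. For a bi-while this is an induction on
  the run of the left loop. Left-only and joint iterations consume an iteration of that run, while
  consecutive right-only iterations terminate because the instrumentation makes them decrease the
  variant. Right-only iterations run the body's \<open>biR\<close>, which commutes with the instrumentation and
  has a left projection equivalent to \<open>Skip\<close>; hence the structural induction treats \<open>B\<close> and
  \<open>biR B\<close> simultaneously.
\<close>

section \<open>Kat equivalence and projections\<close>

inductive_cases SkipE: "cexec Skip s \<phi>"
inductive_cases SeqE: "cexec (Seq c d) s \<phi>"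
inductive_cases CondE: "cexec (Cond e c d) s \<phi>"
inductive_cases WhileE: "cexec (While e v c) s \<phi>"

text \<open>Serves the loop case of \<open>kat_equiv_sound\<close>: exchanging the body along a
  whole run takes an induction on that run.\<close>

lemma cexec_While_mono:
  assumes "cexec (While e v c) s \<phi>" and "\<And>s \<phi>. cexec c s \<phi> \<Longrightarrow> cexec d s \<phi>"
  shows "cexec (While e v d) s \<phi>"
  using assms(1)
  by (induction "While e v c" s \<phi> rule: cexec.induct) (auto intro: cexec.intros assms(2))

lemma kat_equiv_sound: "kat_equiv c d \<Longrightarrow> cexec c s \<phi> \<longleftrightarrow> cexec d s \<phi>"
proof (induction arbitrary: s \<phi> rule: kat_equiv.induct)
  case (k_seq c c' d d')
  then show ?case by (blast elim: SeqE intro: cexec.intros)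
next
  case (k_cond c c' d d' e)
  then show ?case by (blast elim: CondE intro: cexec.intros)
next
  case (k_while c c' e v)
  then show ?case by (blast intro: cexec_While_mono)
next
  case (k_skip_right c)
  \<comment> \<open>The rule that rebuilds \<open>Seq c Skip\<close> depends on the outcome:
    \<open>c_seq_fail\<close> for \<open>Fail\<close>, \<open>c_seq\<close> otherwise.\<close>
  then show ?case by (cases \<phi>) (auto elim!: SeqE SkipE intro: cexec.intros)
qed (auto elim!: SeqE SkipE CondE elim: WhileE intro: cexec.intros)

text \<open>\<open>biR\<close> leaves on the left only \<open>Skip\<close>s, sequences, conditionals
  on \<open>True\<close> and loops on \<open>False\<close>, which the kat axioms collapse.\<close>

lemma projL_biR: "kat_equiv (projL (biR B)) Skip"
proof (induction B)
  case (BSeq B1 B2)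
  then show ?case by (auto intro: k_trans k_seq k_skip_left)
next
  case (BCond e e' B1 B2 B3 B4)
  then show ?case by (auto intro: k_trans k_cond_tt)
qed (auto intro: kat_equiv.intros)

lemma projR_biR: "projR (biR B) = projR B"
  by (induction B) auto

lemma modVarsR_biR: "modVarsR (biR B) = modVarsR B"
  by (induction B) auto

text \<open>The fresh variables of an instrumented loop are computed from \<open>modVarsR\<close> of
  its instrumented body. Both sides pick the same ones only if these lists coincide, so the
  induction carries their equality along.\<close>

lemma biR_chk: "biR (chk fi fb B vs) = chk fi fb (biR B) vs"
proof -
  have "biR (chk fi fb B vs) = chk fi fb (biR B) vs \<and>
        modVarsR (chk fi fb (biR B) vs) = modVarsR (chk fi fb B vs)"
    by (induction B) (auto simp: Let_def)
  then show ?thesis ..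
qed

lemma biR_biR: "biR (biR B) = biR B"
  by (induction B) auto

text \<open>This is the shape of the left projection of an instrumented loop body: its two
  \<open>Havf\<close> and its final \<open>BAssert\<close> project to \<open>Skip\<close>.\<close>

lemma kat_equiv_Skips: "kat_equiv c d \<Longrightarrow> kat_equiv (Seq Skip (Seq Skip (Seq c Skip))) d"
  by (meson k_trans k_skip_left k_skip_right)

lemma projL_chk: "kat_equiv (projL (chk fi fb B vs)) (projL B)"
proof (induction B)
  case (BWhile e e' P P' E B)
  then show ?case
    by (simp add: Let_def k_while kat_equiv_Skips)
qed (auto intro: kat_equiv.intros)

section \<open>Agreement of stores\<close>

lemma agree_refl [simp]: "agree vs s s"
  by (simp add: agree_def)

lemma agree_trans: "agree vs s t \<Longrightarrow> agree vs t u \<Longrightarrow> agree vs s u"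
  by (simp add: agree_def)

lemma agree_upd_int: "agree vs s t \<Longrightarrow> agree vs (upd_int s i n) (upd_int t i n)"
  by (simp add: agree_def upd_int_def)

lemma agree_upd_bool: "agree vs s t \<Longrightarrow> agree vs (upd_bool s i b) (upd_bool t i b)"
  by (simp add: agree_def upd_bool_def)

lemma agree_upd_int_fresh: "IVar i \<notin> set vs \<Longrightarrow> agree vs s (upd_int s i n)"
  by (auto simp: agree_def upd_int_def)

lemma agree_upd_bool_fresh: "BVar i \<notin> set vs \<Longrightarrow> agree vs s (upd_bool s i b)"
  by (auto simp: agree_def upd_bool_def)

lemma agree_updates: "t \<in> updates s x \<Longrightarrow> x \<notin> set vs \<Longrightarrow> agree vs s t"
  by (cases x) (auto intro: agree_upd_int_fresh agree_upd_bool_fresh)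

lemma updates_agree:
  assumes "agree vs s u" and "w \<in> updates u x"
  obtains t where "t \<in> updates s x" and "agree vs t w"
  using assms by (cases x) (auto intro: agree_upd_int agree_upd_bool)

text \<open>Applied below to lists of auxiliary variables rather than to the frame: a snapshot kept
  in a fresh variable survives the loop body.\<close>

lemma cexec_agree:
  "cexec c s \<phi> \<Longrightarrow> \<phi> = Final t \<Longrightarrow> set vs \<inter> set (modVars c) = {} \<Longrightarrow> agree vs s t"
proof (induction arbitrary: t rule: cexec.induct)
  case (c_hav t s x)
  then show ?case by (auto intro: agree_updates)
qed (auto intro: agree_upd_int_fresh agree_upd_bool_fresh agree_trans simp: Int_Un_distrib)

lemma bexec_agree:
  "bexec B p \<phi> \<Longrightarrow> \<phi> = Final q \<Longrightarrow> set vs \<inter> set (modVarsR B) = {} \<Longrightarrow> agree vs (snd p) (snd q)"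
proof (induction arbitrary: q rule: bexec.induct)
  case (b_havf t' s' x s P)
  then show ?case by (auto intro: agree_updates)
qed (auto simp: Int_Un_distrib biL_def modVarsR_biR intro: agree_trans cexec_agree)

section \<open>Simulation of the instrumented programs\<close>

lemma exp_frameD: "exp_frame vs e \<Longrightarrow> agree vs s t \<Longrightarrow> e s = e t"
  by (simp add: exp_frame_def)

lemma rel_frameD: "rel_frame vs P \<Longrightarrow> agree vs s' t' \<Longrightarrow> (s, s') \<in> P \<longleftrightarrow> (s, t') \<in> P"
  using agree_refl unfolding rel_frame_def by blast

lemma exp2_frameD: "exp2_frame vs E \<Longrightarrow> agree vs s' t' \<Longrightarrow> E (s, s') = E (s, t')"
  using agree_refl unfolding exp2_frame_def by blast

text \<open>Each iteration of an instrumented loop asserts that the variant is nonnegative and has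
  decreased. Absence of failure therefore yields an actual terminating run.\<close>

lemma uchk_simulation:
  assumes fresh: "fresh_choice fi fb"
  shows "cFrame c vs \<Longrightarrow> agree vs s u \<Longrightarrow> \<not> cexec (uchk fi c vs) u Fail \<Longrightarrow>
    \<exists>t w. cexec c s (Final t) \<and> cexec (uchk fi c vs) u (Final w) \<and> agree vs t w"
proof (induction c arbitrary: s u)
  case Skip
  then show ?case by (auto intro: cexec.intros)
next
  case (AssignI i e)
  then have "e s = e u" by (auto dest: exp_frameD)
  then have "cexec (AssignI i e) s (Final (upd_int s i (e u)))" by (metis c_assignI)
  with AssignI show ?case by (auto intro: agree_upd_int c_assignI)
next
  case (AssignB i e)
  then have "e s = e u" by (auto dest: exp_frameD)
  then have "cexec (AssignB i e) s (Final (upd_bool s i (e u)))" using c_assignB[of i e s] by simp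
  with AssignB show ?case by (auto intro: agree_upd_bool c_assignB)
next
  case (Hav x)
  \<comment> \<open>Any value will do; the instrumented run keeps the current value of
    \<open>x\<close>, and the other run copies it.\<close>
  have "u \<in> updates u x"
  proof (cases x)
    case (IVar i)
    have "u = upd_int u i (ints u i)" by (simp add: upd_int_def)
    with IVar show ?thesis by (metis rangeI updates.simps(1))
  next
    case (BVar i)
    have "u = upd_bool u i (bools u i)" by (simp add: upd_bool_def)
    with BVar show ?thesis by (metis rangeI updates.simps(2))
  qed
  with updates_agree[OF Hav.prems(2) this] show ?case
    by (metis c_hav uchk.simps(4))
next
  case (Assert p)
  then have "u \<in> p" by (auto intro: c_assert_fail)
  with Assert have "s \<in> p" by (auto simp: assn_frame_def)
  with \<open>u \<in> p\<close> Assert show ?case by (auto intro: c_assert)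
next
  case (Seq c d)
  from Seq.prems have "\<not> cexec (uchk fi c vs) u Fail" by (auto intro: c_seq_fail)
  with Seq obtain t w where c: "cexec c s (Final t)" "cexec (uchk fi c vs) u (Final w)"
    "agree vs t w" by fastforce
  with Seq.prems have "\<not> cexec (uchk fi d vs) w Fail" by (auto intro: c_seq)
  with Seq c obtain t' w' where "cexec d t (Final t')" "cexec (uchk fi d vs) w (Final w')"
    "agree vs t' w'" by fastforce
  with c show ?case by (auto intro: c_seq)
next
  case (Cond e c d)
  then have e: "e s = e u" by (auto dest: exp_frameD)
  show ?case
  proof (cases "e u")
    case True
    with Cond.prems have "\<not> cexec (uchk fi c vs) u Fail" by (auto intro: c_cond_true)
    with Cond.IH(1) Cond.prems True e show ?thesis by (fastforce intro: c_cond_true)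
  next
    case False
    with Cond.prems have "\<not> cexec (uchk fi d vs) u Fail" by (auto intro: c_cond_false)
    with Cond.IH(2) Cond.prems False e show ?thesis by (fastforce intro: c_cond_false)
  qed
next
  case (While e v c)
  define x where "x = fi (vs @ modVars (uchk fi c vs))"
  have x: "IVar x \<notin> set vs" "IVar x \<notin> set (modVars (uchk fi c vs))"
    using fresh unfolding fresh_choice_def x_def by (metis UnCI set_append)+
  let ?p = "{s. 0 \<le> v s \<and> v s < ints s x}"
  let ?b = "Seq (AssignI x v) (Seq (uchk fi c vs) (Assert ?p))"
  let ?w = "While e v ?b"
  have w: "uchk fi (While e v c) vs = ?w" by (simp add: x_def Let_def)
  have frame: "exp_frame vs e" "exp_frame vs v" "cFrame c vs" using While.prems by auto
  have "\<exists>t w. cexec (While e v c) s (Final t) \<and> cexec ?w u (Final w) \<and> agree vs t w"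
    if "agree vs s u" "\<not> cexec ?w u Fail" for s u
    using that
  \<comment> \<open>The variant may be negative on entry. If an iteration passes its assertion, then
    \<open>0 \<le> v y < v u\<close>, so \<open>nat\<close> still decreases strictly.\<close>
  proof (induction "nat (v u)" arbitrary: s u rule: less_induct)
    case less
    have e: "e s = e u" using less.prems frame by (auto dest: exp_frameD)
    show ?case
    proof (cases "e u")
      case False
      with e less.prems show ?thesis by (blast intro: c_while_done)
    next
      case True
      define u1 where "u1 = upd_int u x (v u)"
      have u1: "cexec (AssignI x v) u (Final u1)" unfolding u1_def by (rule c_assignI)
      have "agree vs s u1"
        unfolding u1_def using less.prems x by (blast intro: agree_trans agree_upd_int_fresh)
      have nf: "\<not> cexec ?b u Fail" using less.prems True by (blast intro: c_while_fail)
      then have "\<not> cexec (uchk fi c vs) u1 Fail"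
        using u1 by (blast intro: c_seq c_seq_fail)
      with While.IH[OF frame(3) \<open>agree vs s u1\<close>] obtain t y where
        t: "cexec c s (Final t)" and y: "cexec (uchk fi c vs) u1 (Final y)" and ty: "agree vs t y"
        by blast
      have "y \<in> ?p" using nf u1 y by (blast intro: c_seq c_assert_fail)
      have b: "cexec ?b u (Final y)" using u1 y \<open>y \<in> ?p\<close> by (blast intro: c_seq c_assert)
      have "agree [IVar x] u1 y" using y x by (auto intro: cexec_agree)
      then have "ints y x = v u" by (simp add: agree_def u1_def upd_int_def)
      with \<open>y \<in> ?p\<close> have dec: "nat (v y) < nat (v u)" by auto
      have "\<not> cexec ?w y Fail" using less.prems True b by (blast intro: c_while_step)
      from less.hyps[OF dec ty this] obtain t' y' where
        "cexec (While e v c) t (Final t')" "cexec ?w y (Final y')" "agree vs t' y'" by blast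
      with True e t b show ?thesis by (blast intro: c_while_step)
    qed
  qed
  with While.prems w show ?case by simp
qed

text \<open>The bicom \<open>C\<close> runs on the same left stores as \<open>c\<close>, but its right stores agree with those of
  \<open>c'\<close> only on \<open>vs\<close>, since it may use auxiliary variables.\<close>

definition simulated :: "var list \<Rightarrow> com \<Rightarrow> com \<Rightarrow> bicom \<Rightarrow> bool" where
  "simulated vs c c' C \<longleftrightarrow>
     (\<forall>s s' u'. agree vs s' u' \<longrightarrow> \<not> bexec C (s, u') Fail \<longrightarrow>
        \<not> cexec c s Fail \<and>
        (\<forall>t. cexec c s (Final t) \<longrightarrow>
          (\<exists>t' w'. cexec c' s' (Final t') \<and> bexec C (s, u') (Final (t, w')) \<and> agree vs t' w')))"

lemma simulatedI:
  assumes "\<And>s s' u'. agree vs s' u' \<Longrightarrow> \<not> bexec C (s, u') Fail \<Longrightarrow> \<not> cexec c s Fail"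
    and "\<And>s s' u' t. agree vs s' u' \<Longrightarrow> \<not> bexec C (s, u') Fail \<Longrightarrow> cexec c s (Final t) \<Longrightarrow>
      \<exists>t' w'. cexec c' s' (Final t') \<and> bexec C (s, u') (Final (t, w')) \<and> agree vs t' w'"
  shows "simulated vs c c' C"
  unfolding simulated_def using assms by blast

lemma simulated_not_Fail:
  "simulated vs c c' C \<Longrightarrow> agree vs s' u' \<Longrightarrow> \<not> bexec C (s, u') Fail \<Longrightarrow> \<not> cexec c s Fail"
  unfolding simulated_def by blast

lemma simulatedE:
  assumes "simulated vs c c' C" "agree vs s' u'" "\<not> bexec C (s, u') Fail" "cexec c s (Final t)"
  obtains t' w' where "cexec c' s' (Final t')" "bexec C (s, u') (Final (t, w'))" "agree vs t' w'"
  using assms unfolding simulated_def by blast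

text \<open>Needed because well-formedness matches the projections of conditional branches only up
  to kat equivalence.\<close>

lemma simulated_kat:
  assumes "simulated vs c c' C" "kat_equiv c d" "kat_equiv c' d'"
  shows "simulated vs d d' C"
  using assms unfolding simulated_def by (simp add: kat_equiv_sound)

lemma simulated_Embed:
  assumes "fresh_choice fi fb" "cFrame c' vs"
  shows "simulated vs c c' (Embed c (uchk fi c' vs))"
proof (rule simulatedI)
  fix s s' u' assume "\<not> bexec (Embed c (uchk fi c' vs)) (s, u') Fail"
  then show "\<not> cexec c s Fail" by (blast intro: b_embed_failL)
next
  fix s s' u' t
  assume 1: "agree vs s' u'" and nf: "\<not> bexec (Embed c (uchk fi c' vs)) (s, u') Fail"
    and t: "cexec c s (Final t)"
  \<comment> \<open>The right command can cause failure only once the left one has terminated, so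
    its safety depends on the run to \<open>t\<close>.\<close>
  from nf t have "\<not> cexec (uchk fi c' vs) u' Fail" by (blast intro: b_embed_failR)
  from uchk_simulation[OF assms 1 this] t
  show "\<exists>t' w'. cexec c' s' (Final t') \<and>
    bexec (Embed c (uchk fi c' vs)) (s, u') (Final (t, w')) \<and> agree vs t' w'"
    by (blast intro: b_embed)
qed

lemma simulated_BAssert: "simulated vs Skip Skip (BAssert P)"
proof (rule simulatedI)
  fix s s' u' t
  assume 1: "agree vs s' u'" and nf: "\<not> bexec (BAssert P) (s, u') Fail"
    and t: "cexec Skip s (Final t)"
  from nf have "(s, u') \<in> P" by (blast intro: b_assert_fail)
  with t 1 show "\<exists>t' w'. cexec Skip s' (Final t') \<and> bexec (BAssert P) (s, u') (Final (t, w')) \<and>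
    agree vs t' w'"
    by (blast elim: SkipE intro: b_assert c_skip)
qed (auto elim: SkipE)

text \<open>Without a suitable value \<open>Havf\<close> has no outcome at all, not even
  \<open>Fail\<close>. The preceding assertion makes this case fail, so non-failure supplies the
  value.\<close>

lemma simulated_Havf: "simulated vs Skip (Hav x) (BSeq (BAssert (ex_right x P)) (Havf x P))"
proof (rule simulatedI)
  let ?C = "BSeq (BAssert (ex_right x P)) (Havf x P)"
  fix s s' u' t
  assume 1: "agree vs s' u'" and nf: "\<not> bexec ?C (s, u') Fail"
    and t: "cexec Skip s (Final t)"
  from nf have ex: "(s, u') \<in> ex_right x P" by (blast intro: b_seq_fail b_assert_fail)
  then obtain w' where w': "w' \<in> updates u' x" "(s, w') \<in> P" by (auto simp: ex_right_def)
  with 1 obtain t' where "t' \<in> updates s' x" "agree vs t' w'" by (blast elim: updates_agree)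
  moreover have "bexec ?C (s, u') (Final (s, w'))"
    using ex w' by (blast intro: b_seq b_assert b_havf)
  ultimately show "\<exists>t' w'. cexec (Hav x) s' (Final t') \<and> bexec ?C (s, u') (Final (t, w')) \<and>
    agree vs t' w'"
    using t by (blast elim: SkipE intro: c_hav)
qed (auto elim: SkipE)

lemma simulated_BSeq:
  assumes C: "simulated vs c c' C" and D: "simulated vs d d' D"
  shows "simulated vs (Seq c d) (Seq c' d') (BSeq C D)"
proof (rule simulatedI)
  fix s s' u'
  assume 1: "agree vs s' u'" and nf: "\<not> bexec (BSeq C D) (s, u') Fail"
  have nfC: "\<not> bexec C (s, u') Fail" using nf by (blast intro: b_seq_fail)
  show "\<not> cexec (Seq c d) s Fail"
  proof
    assume "cexec (Seq c d) s Fail"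
    moreover have "\<not> cexec c s Fail" using simulated_not_Fail[OF C 1 nfC] .
    ultimately obtain t where t: "cexec c s (Final t)" "cexec d t Fail" by (blast elim: SeqE)
    from simulatedE[OF C 1 nfC t(1)] obtain t' w'
      where w': "bexec C (s, u') (Final (t, w'))" "agree vs t' w'" by blast
    have "\<not> bexec D (t, w') Fail" using nf w' by (blast intro: b_seq)
    with simulated_not_Fail[OF D w'(2)] t show False by blast
  qed
next
  fix s s' u' r
  assume 1: "agree vs s' u'" and nf: "\<not> bexec (BSeq C D) (s, u') Fail"
    and "cexec (Seq c d) s (Final r)"
  then obtain t where t: "cexec c s (Final t)" "cexec d t (Final r)" by (blast elim: SeqE)
  have nfC: "\<not> bexec C (s, u') Fail" using nf by (blast intro: b_seq_fail)
  obtain t' w'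
    where w': "cexec c' s' (Final t')" "bexec C (s, u') (Final (t, w'))" "agree vs t' w'"
    using simulatedE[OF C 1 nfC t(1)] .
  have "\<not> bexec D (t, w') Fail" using nf w' by (blast intro: b_seq)
  then obtain r' y' where "cexec d' t' (Final r')" "bexec D (t, w') (Final (r, y'))"
    "agree vs r' y'"
    using simulatedE[OF D w'(3) _ t(2)] by blast
  with w' show "\<exists>t' w'. cexec (Seq c' d') s' (Final t') \<and>
    bexec (BSeq C D) (s, u') (Final (r, w')) \<and> agree vs t' w'"
    by (blast intro: b_seq c_seq)
qed

lemma simulated_BCond:
  assumes e': "exp_frame vs e'"
    and sim: "simulated vs c c' C1" "simulated vs c d' C2"
      "simulated vs d c' C3" "simulated vs d d' C4"
  shows "simulated vs (Cond e c d) (Cond e' c' d') (BCond e e' C1 C2 C3 C4)"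
    (is "simulated vs ?c ?c' ?C")
proof -
  \<comment> \<open>The selected branch, which lets the four cases be handled at once; the right
    guard is read in the instrumented store.\<close>
  define C where "C s u' = (if e s then (if e' u' then C1 else C2) else (if e' u' then C3 else C4))"
    for s u'
  have C_exec: "bexec ?C (s, u') \<phi>" if "bexec (C s u') (s, u') \<phi>" for s u' \<phi>
    using that by (auto simp: C_def intro: bexec.intros split: if_splits)
  have C_sim: "simulated vs (if e s then c else d) (if e' u' then c' else d') (C s u')" for s u'
    using sim by (auto simp: C_def)
  have c: "cexec ?c s \<phi> \<longleftrightarrow> cexec (if e s then c else d) s \<phi>" for s \<phi>
    by (auto elim: CondE intro: c_cond_true c_cond_false)
  show ?thesis
  proof (rule simulatedI)
    fix s s' u' assume "agree vs s' u'" "\<not> bexec ?C (s, u') Fail"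
    then show "\<not> cexec ?c s Fail"
      using simulated_not_Fail[OF C_sim] C_exec c by blast
  next
    fix s s' u' t
    assume 1: "agree vs s' u'" "\<not> bexec ?C (s, u') Fail" "cexec ?c s (Final t)"
    obtain t' w' where t': "cexec (if e' u' then c' else d') s' (Final t')"
      "bexec (C s u') (s, u') (Final (t, w'))" "agree vs t' w'"
      using simulatedE[OF C_sim 1(1)] 1 C_exec c by blast
    moreover have "e' s' = e' u'" using e' 1(1) by (rule exp_frameD)
    ultimately have "cexec ?c' s' (Final t')"
      by (auto intro: c_cond_true c_cond_false split: if_splits)
    with t' show "\<exists>t' w'. cexec ?c' s' (Final t') \<and> bexec ?C (s, u') (Final (t, w')) \<and>
      agree vs t' w'"
      using C_exec by blast
  qed
qed

section \<open>Bi-while\<close>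

text \<open>The loop body built by \<open>chk\<close>, with the fresh variables and inner body as
  parameters, so that \<open>biR\<close> of it has the same form.\<close>

definition instrumented ::
    "nat \<Rightarrow> nat \<Rightarrow> bexp \<Rightarrow> store rel \<Rightarrow> iexp2 \<Rightarrow> bicom \<Rightarrow> bicom" where
  "instrumented x1 x2 e' P' E C =
     BSeq (Havf (IVar x1) {(s, s'). ints s' x1 = E (s, s')})
    (BSeq (Havf (BVar x2) {(s, s'). bools s' x2 \<longleftrightarrow> e' s' \<and> (s, s') \<in> P'})
    (BSeq C
          (BAssert {(s, s'). bools s' x2 \<longrightarrow> 0 \<le> E (s, s') \<and> E (s, s') < ints s' x1})))"

text \<open>\<open>x1\<close> records the variant and \<open>x2\<close> whether right guard and
  right alignment hold at the start of the iteration. Since \<open>C\<close> changes neither, the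
  final assertion is a strict decrease when both hold and vacuous otherwise.\<close>

lemma instrumented_step:
  assumes sim: "simulated vs c c' C"
    and frame: "exp_frame vs e'" "rel_frame vs P'" "exp2_frame vs E"
    and fresh: "IVar x1 \<notin> set vs \<union> set (modVarsR C)" "BVar x2 \<notin> set vs \<union> set (modVarsR C)"
    and agree: "agree vs s' u'"
    and nf: "\<not> bexec (instrumented x1 x2 e' P' E C) (s, u') Fail"
  shows instrumented_not_Fail: "\<not> cexec c s Fail"
    and instrumented_Final: "cexec c s (Final t) \<Longrightarrow>
      \<exists>t' w'. cexec c' s' (Final t') \<and>
        bexec (instrumented x1 x2 e' P' E C) (s, u') (Final (t, w')) \<and> agree vs t' w' \<and>
        (e' u' \<and> (s, u') \<in> P' \<longrightarrow> 0 \<le> E (t, w') \<and> E (t, w') < E (s, u'))"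
proof -
  let ?H1 = "Havf (IVar x1) {(s, s'). ints s' x1 = E (s, s')}"
  let ?H2 = "Havf (BVar x2) {(s, s'). bools s' x2 \<longleftrightarrow> e' s' \<and> (s, s') \<in> P'}"
  let ?A = "{(s, s'). bools s' x2 \<longrightarrow> 0 \<le> E (s, s') \<and> E (s, s') < ints s' x1}"
  define y where "y = upd_int u' x1 (E (s, u'))"
  define z where "z = upd_bool y x2 (e' u' \<and> (s, u') \<in> P')"
  have uy: "agree vs u' y" using fresh by (simp add: y_def agree_upd_int_fresh)
  then have uz: "agree vs u' z"
    using fresh unfolding z_def by (blast intro: agree_trans agree_upd_bool_fresh)
  \<comment> \<open>\<open>E\<close> does not depend on the fresh \<open>x1\<close>, so the value
    \<open>E (s, u')\<close> solves the constraint of the first \<open>Havf\<close>.\<close>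
  have "E (s, y) = E (s, u')" using exp2_frameD[OF frame(3) uy] by simp
  then have H1: "bexec ?H1 (s, u') (Final (s, y))"
    by (intro b_havf) (auto simp: y_def upd_int_def)
  have "e' z = e' u'" "(s, z) \<in> P' \<longleftrightarrow> (s, u') \<in> P'"
    using exp_frameD[OF frame(1) uz] rel_frameD[OF frame(2) uz] by auto
  then have H2: "bexec ?H2 (s, y) (Final (s, z))"
    by (intro b_havf) (auto simp: z_def upd_bool_def)
  have nfCA: "\<not> bexec (BSeq C (BAssert ?A)) (s, z) Fail"
    using nf H1 H2 unfolding instrumented_def by (blast intro: b_seq)
  then have nfC: "\<not> bexec C (s, z) Fail" by (blast intro: b_seq_fail)
  have sz: "agree vs s' z" using agree uz by (rule agree_trans)
  show "\<not> cexec c s Fail" using simulated_not_Fail[OF sim sz nfC] .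
  assume "cexec c s (Final t)"
  then obtain t' w' where
    w': "cexec c' s' (Final t')" "bexec C (s, z) (Final (t, w'))" "agree vs t' w'"
    using simulatedE[OF sim sz nfC] by blast
  have A: "(t, w') \<in> ?A" using nfCA w'(2) by (blast intro: b_seq b_assert_fail)
  have "bexec (instrumented x1 x2 e' P' E C) (s, u') (Final (t, w'))"
    unfolding instrumented_def using H1 H2 w'(2) A by (blast intro: b_seq b_assert)
  moreover have "agree [IVar x1, BVar x2] z w'"
    using bexec_agree[OF w'(2) refl, of "[IVar x1, BVar x2]"] fresh by simp
  then have "ints w' x1 = E (s, u')" "bools w' x2 \<longleftrightarrow> e' u' \<and> (s, u') \<in> P'"
    by (auto simp: agree_def z_def y_def upd_int_def upd_bool_def)
  ultimately show "\<exists>t' w'. cexec c' s' (Final t') \<and>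
      bexec (instrumented x1 x2 e' P' E C) (s, u') (Final (t, w')) \<and> agree vs t' w' \<and>
      (e' u' \<and> (s, u') \<in> P' \<longrightarrow> 0 \<le> E (t, w') \<and> E (t, w') < E (s, u'))"
    using w' A by (intro exI[of _ t'] exI[of _ w']) auto
qed

text \<open>Joint, right-only and left-only iterations rest on \<open>both\<close>,
  \<open>right\<close> and \<open>left\<close> respectively. Left guard and left alignment are
  arbitrary, so that \<open>biR\<close> of a loop, with \<open>False\<close> and the empty relation,
  is covered too.\<close>

lemma simulated_BWhile:
  assumes both: "simulated vs c c' C" and right: "simulated vs Skip c' (biR C)"
    and left: "kat_equiv (projL C) c"
    and frame: "exp_frame vs e'" "rel_frame vs P'" "exp2_frame vs E"
    and fresh: "IVar x1 \<notin> set vs \<union> set (modVarsR C)" "BVar x2 \<notin> set vs \<union> set (modVarsR C)"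
  shows "simulated vs (While e v c) (While e' v' c')
    (BWhile e e' P P' E (instrumented x1 x2 e' P' E C))"
    (is "simulated vs ?c ?c' (BWhile _ _ _ _ _ ?D)")
proof -
  let ?W = "BWhile e e' P P' E ?D"
  have biR_D: "biR ?D = instrumented x1 x2 e' P' E (biR C)" by (simp add: instrumented_def)
  have "kat_equiv (projL ?D) c"
    using left by (simp add: instrumented_def kat_equiv_Skips)
  note projL_D = kat_equiv_sound[OF this]
  note both_step = instrumented_step[OF both frame fresh]
  note right_step = instrumented_step[OF right frame fresh[folded modVarsR_biR[of C]], folded biR_D]
  \<comment> \<open>The negation of the condition under which the bi-while takes a right-only
    iteration.\<close>
  define rightmost where
    "rightmost s u' \<longleftrightarrow> e s \<and> (s, u') \<in> P \<or> \<not> (e' u' \<and> (s, u') \<in> P')" for s u'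
  \<comment> \<open>Right-only iterations are exhausted by induction on the variant; the left side
    runs \<open>Skip\<close>, so \<open>s\<close> is fixed. Lifting every outcome back to the start
    makes the iterations a prefix of later runs.\<close>
  have right_steps: "\<exists>r' w'. agree vs r' w' \<and> rightmost s w' \<and> \<not> bexec ?W (s, w') Fail \<and>
      (\<forall>\<phi>. cexec ?c' r' \<phi> \<longrightarrow> cexec ?c' s' \<phi>) \<and> (\<forall>\<phi>. bexec ?W (s, w') \<phi> \<longrightarrow> bexec ?W (s, u') \<phi>)"
    if "agree vs s' u'" "\<not> bexec ?W (s, u') Fail" for s s' u'
    using that
  proof (induction "nat (E (s, u'))" arbitrary: s' u' rule: less_induct)
    case less
    show ?case
    proof (cases "rightmost s u'")
      case True
      with less.prems show ?thesis by blast
    next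
      case False
      then have g: "\<not> (e s \<and> (s, u') \<in> P)" "e' u'" "(s, u') \<in> P'" by (auto simp: rightmost_def)
      then have nf: "\<not> bexec (biR ?D) (s, u') Fail"
        using less.prems(2) by (blast intro: b_while_right_fail)
      from right_step(2)[OF less.prems(1) nf c_skip] g obtain r' w' where
        r': "cexec c' s' (Final r')" and w': "bexec (biR ?D) (s, u') (Final (s, w'))"
        and ag: "agree vs r' w'" and dec: "0 \<le> E (s, w')" "E (s, w') < E (s, u')" by blast
      have W: "bexec ?W (s, u') \<phi>" if "bexec ?W (s, w') \<phi>" for \<phi>
        using b_while_right[OF g w' that] .
      have "e' s'" using exp_frameD[OF frame(1) less.prems(1)] g by simp
      then have c': "cexec ?c' s' \<phi>" if "cexec ?c' r' \<phi>" for \<phi>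
        using r' that by (rule c_while_step)
      have "nat (E (s, w')) < nat (E (s, u'))" using dec by auto
      from less.hyps[OF this ag] less.prems(2) W c' show ?thesis by blast
    qed
  qed
  \<comment> \<open>Allowing any outcome, and concluding that it is \<open>Final\<close>, proves
    safety and matching in one induction.\<close>
  have main: "\<exists>t t' w'. \<phi> = Final t \<and> cexec ?c' s' (Final t') \<and>
      bexec ?W (s, u') (Final (t, w')) \<and> agree vs t' w'"
    if "cexec ?c s \<phi>" "agree vs s' u'" "\<not> bexec ?W (s, u') Fail" for s s' u' \<phi>
    using that
  proof (induction ?c s \<phi> arbitrary: s' u' rule: cexec.induct)
    case (c_while_done s)
    from right_steps[OF this(2,3)] obtain r' y' where
      y': "agree vs r' y'" "rightmost s y'" "\<not> bexec ?W (s, y') Fail"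
      "\<And>\<phi>. cexec ?c' r' \<phi> \<Longrightarrow> cexec ?c' s' \<phi>" "\<And>\<phi>. bexec ?W (s, y') \<phi> \<Longrightarrow> bexec ?W (s, u') \<phi>"
      by blast
    \<comment> \<open>With the left guard false and no right-only iteration possible, a true right
      guard would be stuck and hence fail.\<close>
    have "\<not> e' y'"
      using y'(2,3) c_while_done(1) by (auto simp: rightmost_def intro: b_while_stuckR)
    moreover from this have "\<not> e' r'" using exp_frameD[OF frame(1) y'(1)] by simp
    ultimately show ?case
      using y' c_while_done(1) by (blast intro: b_while_done cexec.c_while_done)
  next
    case (c_while_fail s)
    from right_steps[OF c_while_fail(4,5)] obtain r' y' where
      y': "agree vs r' y'" "rightmost s y'" "\<not> bexec ?W (s, y') Fail" by blast
    \<comment> \<open>A left-only iteration would run this failing projection, so \<open>P\<close>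
      is false; a false \<open>e'\<close> would be stuck, and \<open>rightmost\<close> then excludes
      \<open>P'\<close>. Only a joint iteration remains, and it contradicts
      \<open>both\<close>.\<close>
    have "cexec (projL ?D) s Fail" using c_while_fail projL_D by blast
    then have "bexec (biL ?D) (s, y') Fail" unfolding biL_def by (rule b_embed_failL)
    then have P: "(s, y') \<notin> P"
      using y'(3) c_while_fail(1) by (blast intro: b_while_left_fail)
    then have g: "e' y'" "(s, y') \<notin> P'"
      using y'(2,3) c_while_fail(1) by (auto simp: rightmost_def intro: b_while_stuckL)
    then have "\<not> bexec ?D (s, y') Fail"
      using y'(3) P c_while_fail(1) by (blast intro: b_while_both_fail)
    from both_step(1)[OF y'(1) this] c_while_fail show ?case by blast
  next
    case (c_while_step s t \<phi>)
    from right_steps[OF c_while_step(6,7)] obtain r' y' where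
      y': "agree vs r' y'" "rightmost s y'" "\<not> bexec ?W (s, y') Fail"
      "\<And>\<phi>. cexec ?c' r' \<phi> \<Longrightarrow> cexec ?c' s' \<phi>" "\<And>\<phi>. bexec ?W (s, y') \<phi> \<Longrightarrow> bexec ?W (s, u') \<phi>"
      by blast
    show ?case
    proof (cases "(s, y') \<in> P")
      case True
      \<comment> \<open>The right side idles, so the rest of the left run is matched from the same
        \<open>r'\<close> and \<open>y'\<close>.\<close>
      have "bexec (biL ?D) (s, y') (Final (t, y'))"
        using c_while_step(2) projL_D by (auto simp: biL_def intro: b_embed c_skip)
      then have W: "bexec ?W (s, y') \<psi>" if "bexec ?W (t, y') \<psi>" for \<psi>
        using b_while_left c_while_step(1) True that by blast
      then show ?thesis using c_while_step(5)[OF y'(1)] y'(3-5) by blast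
    next
      case False
      then have g: "e' y'" "(s, y') \<notin> P'"
        using y'(2,3) c_while_step(1) by (auto simp: rightmost_def intro: b_while_stuckL)
      then have "\<not> bexec ?D (s, y') Fail"
        using y'(3) False c_while_step(1) by (blast intro: b_while_both_fail)
      from both_step(2)[OF y'(1) this c_while_step(2)] obtain t' w' where
        w': "cexec c' r' (Final t')" "bexec ?D (s, y') (Final (t, w'))" "agree vs t' w'" by blast
      have W: "bexec ?W (s, y') \<psi>" if "bexec ?W (t, w') \<psi>" for \<psi>
        using b_while_both[OF c_while_step(1) g(1) False g(2) w'(2) that] .
      have "e' r'" using exp_frameD[OF frame(1) y'(1)] g by simp
      then have "cexec ?c' r' \<psi>" if "cexec ?c' t' \<psi>" for \<psi>
        using w'(1) that by (rule cexec.c_while_step)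
      then show ?thesis using c_while_step(5)[OF w'(3)] W y'(3-5) by blast
    qed
  qed
  show ?thesis
    using main by (intro simulatedI) blast+
qed

section \<open>Structural induction\<close>

lemma chk_simulation:
  assumes fresh: "fresh_choice fi fb"
  shows "well_formed B \<Longrightarrow> biFrame B vs \<Longrightarrow>
    simulated vs (projL B) (projR B) (chk fi fb B vs) \<and>
    simulated vs (projL (biR B)) (projR (biR B)) (chk fi fb (biR B) vs)"
proof (induction B)
  case (Embed c c')
  then show ?case using simulated_Embed[OF fresh] by simp
next
  case (BAssert P)
  then show ?case by (simp add: simulated_BAssert)
next
  case (Havf x P)
  then show ?case by (simp add: simulated_Havf)
next
  case (BSeq B1 B2)
  then show ?case by (simp add: simulated_BSeq)
next
  case (BCond e e' B1 B2 B3 B4)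
  have frame: "exp_frame vs e'" using BCond.prems by simp
  from BCond.prems have wf:
    "kat_equiv (projL B2) (projL B1)" "kat_equiv (projL B4) (projL B3)"
    "kat_equiv (projR B3) (projR B1)" "kat_equiv (projR B4) (projR B2)"
    by (auto intro: k_sym)
  \<comment> \<open>After \<open>biR\<close> every left projection is equivalent to
    \<open>Skip\<close>, so the branches match on the left automatically.\<close>
  have L: "kat_equiv (projL (biR B)) (projL (biR B'))" for B B'
    by (blast intro: k_trans k_sym projL_biR)
  from BCond show ?case
    by (auto simp: projR_biR
        intro!: simulated_BCond[OF frame] intro: simulated_kat wf L k_refl)
next
  case (BWhile e e' P P' E B)
  from BWhile.prems have frame: "exp_frame vs e'" "rel_frame vs P'" "exp2_frame vs E" by auto
  let ?C = "chk fi fb B vs"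
  define x1 where "x1 = fi (vs @ modVarsR ?C)"
  define x2 where "x2 = fb (vs @ modVarsR ?C)"
  have x: "IVar x1 \<notin> set vs \<union> set (modVarsR ?C)" "BVar x2 \<notin> set vs \<union> set (modVarsR ?C)"
    using fresh unfolding fresh_choice_def x1_def x2_def by (metis set_append)+
  from BWhile have both: "simulated vs (projL B) (projR B) ?C"
    and right: "simulated vs (projL (biR B)) (projR B) (biR ?C)"
    by (auto simp: projR_biR biR_chk)
  have right': "simulated vs Skip (projR B) (biR ?C)"
    using simulated_kat[OF right projL_biR k_refl] .
  \<comment> \<open>The loop lemma is used a second time with body \<open>biR ?C\<close>. Right-only
    iterations of that loop run \<open>biR (biR ?C)\<close>, hence the idempotence of
    \<open>biR\<close>.\<close>
  have x': "IVar x1 \<notin> set vs \<union> set (modVarsR (biR ?C))"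
      "BVar x2 \<notin> set vs \<union> set (modVarsR (biR ?C))"
    using x by (simp_all add: modVarsR_biR)
  have "biR (biR ?C) = biR ?C" by (simp add: biR_chk biR_biR)
  with right' have right'': "simulated vs Skip (projR B) (biR (biR ?C))" by simp
  have left': "kat_equiv (projL (biR ?C)) (projL (biR B))" by (simp add: biR_chk projL_chk)
  have eq: "chk fi fb (BWhile e e' P P' E B) vs =
      BWhile e e' P P' E (instrumented x1 x2 e' P' E ?C)"
    by (simp add: Let_def instrumented_def x1_def x2_def)
  \<comment> \<open>Going through \<open>biR_chk\<close> retains the variables \<open>x1\<close> and
    \<open>x2\<close> chosen for \<open>?C\<close>.\<close>
  have eq': "chk fi fb (biR (BWhile e e' P P' E B)) vs =
      BWhile (\<lambda>_. False) e' {} P' E (instrumented x1 x2 e' P' E (biR ?C))"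
    unfolding biR_chk[symmetric] eq by (simp add: instrumented_def)
  show ?case
    unfolding eq eq'
    using simulated_BWhile[OF both right' projL_chk frame x]
      simulated_BWhile[OF right right'' left' frame x']
    by (simp add: projR_biR)
qed

theorem theorem5p4:
  fixes B :: bicom and vs :: "var list" and R S :: "store rel"
    and fi fb :: "var list \<Rightarrow> nat"
  assumes "fresh_choice fi fb"
    and "well_formed B"
    and "biFrame B vs"
    and "rel_frame vs R" and "rel_frame vs S"
    and "valid_aa (chk fi fb B vs) R S"
  shows "valid_ae (projL B) (projR B) R S"
proof -
  have sim: "simulated vs (projL B) (projR B) (chk fi fb B vs)"
    using chk_simulation assms(1-3) by blast
  have "\<not> cexec (projL B) s Fail \<and>
      (\<forall>t. cexec (projL B) s (Final t) \<longrightarrow>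
        (\<exists>t'. cexec (projR B) s' (Final t') \<and> (t, t') \<in> S))"
    if "(s, s') \<in> R" for s s'
  proof (intro conjI allI impI)
    have nf: "\<not> bexec (chk fi fb B vs) (s, s') Fail"
      using assms(6) that by (auto simp: valid_aa_def)
    show "\<not> cexec (projL B) s Fail" using simulated_not_Fail[OF sim agree_refl nf] .
    fix t assume "cexec (projL B) s (Final t)"
    then obtain t' w' where t': "cexec (projR B) s' (Final t')" "agree vs t' w'"
      and "bexec (chk fi fb B vs) (s, s') (Final (t, w'))"
      by (rule simulatedE[OF sim agree_refl nf])
    then have "(t, w') \<in> S" using assms(6) that by (auto simp: valid_aa_def)
    \<comment> \<open>Both runs start from the same stores, but their final right stores agree only
      on \<open>vs\<close>; the frame of \<open>S\<close> bridges the gap.\<close>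
    then have "(t, t') \<in> S" using rel_frameD[OF assms(5) t'(2)] by simp
    with t' show "\<exists>t'. cexec (projR B) s' (Final t') \<and> (t, t') \<in> S" by blast
  qed
  then show ?thesis by (auto simp: valid_ae_def)
qed

end
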